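(* Let $(G,m,e)$ be a group with a braiding operator $r(x,y)=(\sigma_x(y),\gamma_y(x))$. Let $\Theta=(\Theta_1,\Theta_2):G^2\to G^2$ be a map such that $F_\Theta:G^2\to G^2$ defined by $F_\Theta(g,h)=\big(\sigma_{\Theta_1(g,h)}(g),\ \sigma_{\Theta_2(g,h)}(h)\big)$ is a bijection, $\Theta_2(e,a)=e=\Theta_1(a,e)$ for all $a\in G$, and for all $a,b,c\in G$: $$\Theta_1\Big(\sigma_{\Theta_1(ab,c)}(a),\ \sigma_{\gamma_a(\Theta_1(ab,c))}(b)\Big)\cdot\Theta_1(ab,c)=\Theta_1(a,bc),$$ $$\Theta_2(ab,c)=\Theta_2\Big(\sigma_{\Theta_2(a,bc)}(b),\ \sigma_{\gamma_b(\Theta_2(a,bc))}(c)\Big)\cdot\gamma_b\big(\Theta_2(a,bc)\big),$$ $$\Theta_2\Big(\sigma_{\Theta_1(ab,c)}(a),\ \sigma_{\gamma_a(\Theta_1(ab,c))}(b)\Big)\cdot\gamma_a\big(\Theta_1(ab,c)\big)=\Theta_1\Big(\sigma_{\Theta_2(a,bc)}(b),\ \sigma_{\gamma_b(\Theta_2(a,bc))}(c)\Big)\cdot\Theta_2(a,bc).$$ Then $(G,mF_\Theta^{-1},e)$ is a group with braiding operator $F_\Theta rF_\Theta^{-1}$.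
   Context: For a map $r:G^2\to G^2$, $r_{12}=r\times\mathrm{id}_G$ and $r_{23}=\mathrm{id}_G\times r$; for a group $(G,m,e)$, $m_{12}(x,y,z)=(xy,z)$ and $m_{23}(x,y,z)=(x,yz)$. Juxtaposition of maps denotes composition; $ab$ and $\cdot$ denote the product $m$ of $G$. A braiding operator on a group $(G,m,e)$ is a map $r:G^2\to G^2$ satisfying $r(e,g)=(g,e)$, $r(g,e)=(e,g)$ for all $g\in G$; $r m_{12}=m_{23}r_{12}r_{23}$; $r m_{23}=m_{12}r_{23}r_{12}$; and $mr=m$. *)

theory Defs
  imports "HOL-Algebra.Group"
begin

text \<open>Triples are right-nested pairs, so \<open>G\<^sup>3\<close> is \<open>carrier G \<times> carrier G \<times> carrier G\<close>.\<close>

definition map12 :: "('a \<times> 'a \<Rightarrow> 'a \<times> 'a) \<Rightarrow> 'a \<times> 'a \<times> 'a \<Rightarrow> 'a \<times> 'a \<times> 'a" where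
  "map12 r = (\<lambda>(x, y, z). case r (x, y) of (u, v) \<Rightarrow> (u, v, z))"

definition map23 :: "('a \<times> 'a \<Rightarrow> 'a \<times> 'a) \<Rightarrow> 'a \<times> 'a \<times> 'a \<Rightarrow> 'a \<times> 'a \<times> 'a" where
  "map23 r = (\<lambda>(x, y, z). (x, r (y, z)))"

definition mult_map :: "('a, 'b) monoid_scheme \<Rightarrow> 'a \<times> 'a \<Rightarrow> 'a" where
  "mult_map G = (\<lambda>(x, y). x \<otimes>\<^bsub>G\<^esub> y)"

definition mult12 :: "('a, 'b) monoid_scheme \<Rightarrow> 'a \<times> 'a \<times> 'a \<Rightarrow> 'a \<times> 'a" where
  "mult12 G = (\<lambda>(x, y, z). (x \<otimes>\<^bsub>G\<^esub> y, z))"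

definition mult23 :: "('a, 'b) monoid_scheme \<Rightarrow> 'a \<times> 'a \<times> 'a \<Rightarrow> 'a \<times> 'a" where
  "mult23 G = (\<lambda>(x, y, z). (x, y \<otimes>\<^bsub>G\<^esub> z))"

text \<open>The predicate does not itself assert that \<open>G\<close> is a group. No bijectivity of \<open>r\<close> is required.\<close>

definition braiding_operator :: "('a, 'b) monoid_scheme \<Rightarrow> ('a \<times> 'a \<Rightarrow> 'a \<times> 'a) \<Rightarrow> bool" where
  "braiding_operator G r \<longleftrightarrow>
     r \<in> carrier G \<times> carrier G \<rightarrow> carrier G \<times> carrier G \<and>
     (\<forall>g \<in> carrier G. r (\<one>\<^bsub>G\<^esub>, g) = (g, \<one>\<^bsub>G\<^esub>) \<and> r (g, \<one>\<^bsub>G\<^esub>) = (\<one>\<^bsub>G\<^esub>, g)) \<and>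
     (\<forall>t \<in> carrier G \<times> carrier G \<times> carrier G.
        (r \<circ> mult12 G) t = (mult23 G \<circ> map12 r \<circ> map23 r) t) \<and>
     (\<forall>t \<in> carrier G \<times> carrier G \<times> carrier G.
        (r \<circ> mult23 G) t = (mult12 G \<circ> map23 r \<circ> map12 r) t) \<and>
     (\<forall>p \<in> carrier G \<times> carrier G. (mult_map G \<circ> r) p = mult_map G p)"

text \<open>In \<open>\<sigma> x y\<close> the first argument is the subscript, so \<open>\<sigma> x y\<close> is \<open>\<sigma>\<^sub>x(y)\<close>.\<close>

definition twist_map :: "('a \<Rightarrow> 'a \<Rightarrow> 'a) \<Rightarrow> ('a \<Rightarrow> 'a \<Rightarrow> 'a) \<Rightarrow> ('a \<Rightarrow> 'a \<Rightarrow> 'a) \<Rightarrow> 'a \<times> 'a \<Rightarrow> 'a \<times> 'a" where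
  "twist_map \<sigma> \<Theta>\<^sub>1 \<Theta>\<^sub>2 = (\<lambda>(g, h). (\<sigma> (\<Theta>\<^sub>1 g h) g, \<sigma> (\<Theta>\<^sub>2 g h) h))"

definition inv_on_pairs :: "('a, 'b) monoid_scheme \<Rightarrow> ('a \<times> 'a \<Rightarrow> 'a \<times> 'a) \<Rightarrow> 'a \<times> 'a \<Rightarrow> 'a \<times> 'a" where
  "inv_on_pairs G F = inv_into (carrier G \<times> carrier G) F"

definition twisted_group :: "('a, 'b) monoid_scheme \<Rightarrow> ('a \<times> 'a \<Rightarrow> 'a \<times> 'a) \<Rightarrow> 'a monoid" where
  "twisted_group G F =
     \<lparr>carrier = carrier G,
      monoid.mult = (\<lambda>x y. (mult_map G \<circ> inv_on_pairs G F) (x, y)),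
      one = \<one>\<^bsub>G\<^esub>\<rparr>"

end

theory Submission
  imports Defs
begin

text \<open>
  Write \<open>F\<close> for the twisting bijection, \<open>m' = m F\<^sup>-\<^sup>1\<close> for the twisted product and \<open>r' = F r F\<^sup>-\<^sup>1\<close> for
  the twisted operator. The proof transports every identity between maps on \<open>G\<^sup>3\<close> from \<open>(m, r)\<close> to
  \<open>(m', r')\<close> along one map \<open>K\<close> from \<open>G\<^sup>3\<close> onto itself, the three-fold analogue of \<open>F\<close>.

  To find \<open>K\<close>, expand \<open>F(ab, c)\<close> and \<open>F(a, bc)\<close> with the product rule
  \<open>\<sigma>\<^sub>x(ab) = \<sigma>\<^sub>x(a) \<sigma>\<^sub>y(b)\<close>, \<open>y = \<gamma>\<^sub>a(x)\<close>. This yields maps \<open>\<Psi>\<close>, \<open>\<Phi>\<close> on \<open>G\<^sup>3\<close> with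
  \<open>F m\<^sub>1\<^sub>2 = m\<^sub>1\<^sub>2 \<Psi>\<close> and \<open>F m\<^sub>2\<^sub>3 = m\<^sub>2\<^sub>3 \<Phi>\<close>, and the three equations imposed on \<open>\<Theta>\<close> say, factor
  by factor, that the subscripts of \<open>\<sigma>\<close> agree in \<open>F\<^sub>1\<^sub>2 \<Psi>\<close> and \<open>F\<^sub>2\<^sub>3 \<Phi>\<close>. So both are the same map
  \<open>K\<close>, and \<open>m'\<^sub>1\<^sub>2 K = F m\<^sub>1\<^sub>2\<close>, \<open>m'\<^sub>2\<^sub>3 K = F m\<^sub>2\<^sub>3\<close> (lemmas \<open>coassociativity\<close>, \<open>mult12_K\<close>,
  \<open>mult23_K\<close>). Moreover \<open>K\<close> is onto because \<open>F\<close> and the maps \<open>\<sigma>\<^sub>x\<close> are bijective (\<open>K_onto\<close>), so an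
  identity may be checked on triples of the form \<open>K(a, b, c)\<close>. Associativity is then immediate:
  both bracketings of \<open>K(a, b, c)\<close> have product \<open>abc\<close>.

  The inverse of \<open>a\<close> is the middle entry of \<open>K(a, a\<^sup>-\<^sup>1, a)\<close>: the first two entries of this triple, and
  also the last two, have twisted product \<open>e\<close>, and its first entry is \<open>a\<close> itself since
  \<open>\<Theta>\<^sub>1(a, e) = e\<close>.

  The braiding axioms on triples follow once \<open>K\<close> intertwines \<open>r\<^sub>1\<^sub>2\<close> with \<open>r'\<^sub>1\<^sub>2\<close> and \<open>r\<^sub>2\<^sub>3\<close> with \<open>r'\<^sub>2\<^sub>3\<close>.
  This reduces to \<open>\<Psi>\<close> commuting with \<open>r\<^sub>1\<^sub>2\<close> and \<open>\<Phi>\<close> with \<open>r\<^sub>2\<^sub>3\<close>. As \<open>r\<close> does not change products,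
  \<open>r\<^sub>1\<^sub>2\<close> leaves \<open>(ab, c)\<close> unchanged and \<open>r\<^sub>2\<^sub>3\<close> leaves \<open>(a, bc)\<close> unchanged, and these are the
  arguments at which \<open>\<Theta>\<close> is evaluated. What remains is that the diagonal map \<open>(a, b) \<mapsto> (\<sigma>\<^sub>x(a), \<sigma>\<^sub>y(b))\<close>, \<open>y = \<gamma>\<^sub>a(x)\<close>, commutes with \<open>r\<close>. This is part of the
  Yang--Baxter equation for \<open>r\<close> (lemma \<open>r_act2\<close>).
\<close>

section \<open>Groups with a braiding operator\<close>

lemma map12_closed:
  assumes "f \<in> A \<times> A \<rightarrow> A \<times> A" "t \<in> A \<times> A \<times> A"
  shows "map12 f t \<in> A \<times> A \<times> A"
  using assms by (force simp: map12_def Pi_iff split: prod.splits)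

lemma map23_closed:
  assumes "f \<in> A \<times> A \<rightarrow> A \<times> A" "t \<in> A \<times> A \<times> A"
  shows "map23 f t \<in> A \<times> A \<times> A"
  using assms by (force simp: map23_def Pi_iff split: prod.splits)

locale braided_group = group G for G :: "('a, 'b) monoid_scheme" (structure) +
  fixes r :: "'a \<times> 'a \<Rightarrow> 'a \<times> 'a" and \<sigma> \<gamma> :: "'a \<Rightarrow> 'a \<Rightarrow> 'a"
  assumes braiding: "braiding_operator G r"
    and r_eq: "\<lbrakk>x \<in> carrier G; y \<in> carrier G\<rbrakk> \<Longrightarrow> r (x, y) = (\<sigma> x y, \<gamma> y x)"
begin

lemma r_closed: "r \<in> carrier G \<times> carrier G \<rightarrow> carrier G \<times> carrier G"
  using braiding by (simp add: braiding_operator_def)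

lemma \<sigma>_closed [simp]: "\<lbrakk>x \<in> carrier G; y \<in> carrier G\<rbrakk> \<Longrightarrow> \<sigma> x y \<in> carrier G"
  and \<gamma>_closed [simp]: "\<lbrakk>x \<in> carrier G; y \<in> carrier G\<rbrakk> \<Longrightarrow> \<gamma> y x \<in> carrier G"
  using funcset_mem[OF r_closed, of "(x, y)"] by (simp_all add: r_eq)

lemma r_one_left: "g \<in> carrier G \<Longrightarrow> r (\<one>, g) = (g, \<one>)"
  and r_one_right: "g \<in> carrier G \<Longrightarrow> r (g, \<one>) = (\<one>, g)"
  using braiding by (auto simp: braiding_operator_def)

lemma \<sigma>_one_left [simp]: "g \<in> carrier G \<Longrightarrow> \<sigma> \<one> g = g"
  and \<sigma>_one_right [simp]: "g \<in> carrier G \<Longrightarrow> \<sigma> g \<one> = \<one>"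
  using r_eq[of \<one> g] r_eq[of g \<one>] r_one_left[of g] r_one_right[of g] by auto

lemma r_mult12:
  assumes "t \<in> carrier G \<times> carrier G \<times> carrier G"
  shows "r (mult12 G t) = mult23 G (map12 r (map23 r t))"
  using braiding assms by (auto simp: braiding_operator_def)

lemma r_mult23:
  assumes "t \<in> carrier G \<times> carrier G \<times> carrier G"
  shows "r (mult23 G t) = mult12 G (map23 r (map12 r t))"
  using braiding assms by (auto simp: braiding_operator_def)

lemma mult_r:
  assumes "p \<in> carrier G \<times> carrier G"
  shows "mult_map G (r p) = mult_map G p"
  using braiding assms by (auto simp: braiding_operator_def)

lemma \<sigma>_mult_\<gamma>:
  assumes "x \<in> carrier G" "y \<in> carrier G"
  shows "\<sigma> x y \<otimes> \<gamma> y x = x \<otimes> y"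
  using mult_r[of "(x, y)"] assms by (simp add: r_eq mult_map_def)

lemma \<sigma>_action:
  assumes "x \<in> carrier G" "y \<in> carrier G" "z \<in> carrier G"
  shows "\<sigma> (x \<otimes> y) z = \<sigma> x (\<sigma> y z)"
  using r_mult12[of "(x, y, z)"] assms
  by (simp add: r_eq mult12_def mult23_def map12_def map23_def)

lemma \<sigma>_mult:
  assumes "x \<in> carrier G" "y \<in> carrier G" "z \<in> carrier G"
  shows "\<sigma> x (y \<otimes> z) = \<sigma> x y \<otimes> \<sigma> (\<gamma> y x) z"
  using r_mult23[of "(x, y, z)"] assms
  by (simp add: r_eq mult12_def mult23_def map12_def map23_def)

lemma \<sigma>_inv_left:
  assumes "x \<in> carrier G" "y \<in> carrier G"
  shows "\<sigma> (inv x) (\<sigma> x y) = y"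
  using \<sigma>_action[of "inv x" x y] assms by simp

lemma \<sigma>_inv_right:
  assumes "x \<in> carrier G" "y \<in> carrier G"
  shows "\<sigma> x (\<sigma> (inv x) y) = y"
  using \<sigma>_action[of x "inv x" y] assms by simp

text \<open>The diagonal action of \<open>x\<close> on \<open>G\<^sup>2\<close>: it is what makes multiplication equivariant for \<open>\<sigma>\<close>.\<close>

definition act2 :: "'a \<Rightarrow> 'a \<times> 'a \<Rightarrow> 'a \<times> 'a" where
  "act2 x = (\<lambda>(a, b). (\<sigma> x a, \<sigma> (\<gamma> a x) b))"

lemma act2_closed:
  assumes "x \<in> carrier G" "p \<in> carrier G \<times> carrier G"
  shows "act2 x p \<in> carrier G \<times> carrier G"
  using assms by (auto simp: act2_def)

lemma mult_act2:
  assumes "x \<in> carrier G" "p \<in> carrier G \<times> carrier G"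
  shows "mult_map G (act2 x p) = \<sigma> x (mult_map G p)"
  using assms by (auto simp: act2_def mult_map_def \<sigma>_mult)

text \<open>
  The first entries agree because \<open>\<sigma>\<close> is an action and \<open>\<sigma>\<^sub>x(a) \<gamma>\<^sub>a(x) = x a\<close>. Since \<open>r\<close> preserves
  products and multiplication is equivariant, both sides also have the same product, so the second
  entries agree by cancellation.
\<close>

lemma r_act2:
  assumes x: "x \<in> carrier G" and p: "p \<in> carrier G \<times> carrier G"
  shows "r (act2 x p) = act2 x (r p)"
proof -
  obtain a b where ab: "p = (a, b)" "a \<in> carrier G" "b \<in> carrier G"
    using p by auto
  have rp: "r p \<in> carrier G \<times> carrier G"
    using r_closed p by auto
  have "\<sigma> (\<sigma> x a) (\<sigma> (\<gamma> a x) b) = \<sigma> (\<sigma> x a \<otimes> \<gamma> a x) b"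
    using x ab by (simp add: \<sigma>_action)
  also have "\<dots> = \<sigma> x (\<sigma> a b)"
    using x ab by (simp add: \<sigma>_mult_\<gamma> \<sigma>_action)
  finally have fst_eq: "fst (r (act2 x p)) = fst (act2 x (r p))"
    using x ab by (simp add: act2_def r_eq)
  have "mult_map G (r (act2 x p)) = \<sigma> x (mult_map G p)"
    using x p by (simp add: mult_r act2_closed mult_act2)
  also have "\<dots> = mult_map G (act2 x (r p))"
    using x p rp by (simp add: mult_r mult_act2)
  finally have mult_eq: "mult_map G (r (act2 x p)) = mult_map G (act2 x (r p))" .
  have mem: "r (act2 x p) \<in> carrier G \<times> carrier G" "act2 x (r p) \<in> carrier G \<times> carrier G"
    using r_closed x p rp act2_closed by auto
  show ?thesis
    using fst_eq mult_eq mem by (auto simp: mult_map_def split: prod.splits)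
qed

lemma act2_onto:
  assumes "x \<in> carrier G" "q \<in> carrier G \<times> carrier G"
  obtains p where "p \<in> carrier G \<times> carrier G" "act2 x p = q"
proof -
  obtain u v where uv: "q = (u, v)" "u \<in> carrier G" "v \<in> carrier G"
    using assms by auto
  define a where "a = \<sigma> (inv x) u"
  define b where "b = \<sigma> (inv (\<gamma> a x)) v"
  have a: "a \<in> carrier G"
    using assms uv by (simp add: a_def)
  have "b \<in> carrier G"
    using assms uv a by (simp add: b_def)
  moreover have "act2 x (a, b) = q"
    using assms uv a by (simp add: act2_def b_def \<sigma>_inv_right) (simp add: a_def \<sigma>_inv_right)
  ultimately show ?thesis
    using a that by blast
qed

end

section \<open>The map on triples induced by a twist\<close>

locale twisted_braided_group = braided_group +
  fixes \<Theta>\<^sub>1 \<Theta>\<^sub>2 :: "'a \<Rightarrow> 'a \<Rightarrow> 'a"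
  assumes \<Theta>\<^sub>1_closed [simp]: "\<lbrakk>a \<in> carrier G; b \<in> carrier G\<rbrakk> \<Longrightarrow> \<Theta>\<^sub>1 a b \<in> carrier G"
    and \<Theta>\<^sub>2_closed [simp]: "\<lbrakk>a \<in> carrier G; b \<in> carrier G\<rbrakk> \<Longrightarrow> \<Theta>\<^sub>2 a b \<in> carrier G"
    and twist_bij: "bij_betw (twist_map \<sigma> \<Theta>\<^sub>1 \<Theta>\<^sub>2)
           (carrier G \<times> carrier G) (carrier G \<times> carrier G)"
    and \<Theta>\<^sub>2_one [simp]: "a \<in> carrier G \<Longrightarrow> \<Theta>\<^sub>2 \<one> a = \<one>"
    and \<Theta>\<^sub>1_one [simp]: "a \<in> carrier G \<Longrightarrow> \<Theta>\<^sub>1 a \<one> = \<one>"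
    and \<Theta>_left: "\<lbrakk>a \<in> carrier G; b \<in> carrier G; c \<in> carrier G\<rbrakk> \<Longrightarrow>
           \<Theta>\<^sub>1 (\<sigma> (\<Theta>\<^sub>1 (a \<otimes> b) c) a) (\<sigma> (\<gamma> a (\<Theta>\<^sub>1 (a \<otimes> b) c)) b) \<otimes> \<Theta>\<^sub>1 (a \<otimes> b) c
             = \<Theta>\<^sub>1 a (b \<otimes> c)"
    and \<Theta>_right: "\<lbrakk>a \<in> carrier G; b \<in> carrier G; c \<in> carrier G\<rbrakk> \<Longrightarrow>
           \<Theta>\<^sub>2 (a \<otimes> b) c
             = \<Theta>\<^sub>2 (\<sigma> (\<Theta>\<^sub>2 a (b \<otimes> c)) b) (\<sigma> (\<gamma> b (\<Theta>\<^sub>2 a (b \<otimes> c))) c) \<otimes> \<gamma> b (\<Theta>\<^sub>2 a (b \<otimes> c))"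
    and \<Theta>_middle: "\<lbrakk>a \<in> carrier G; b \<in> carrier G; c \<in> carrier G\<rbrakk> \<Longrightarrow>
           \<Theta>\<^sub>2 (\<sigma> (\<Theta>\<^sub>1 (a \<otimes> b) c) a) (\<sigma> (\<gamma> a (\<Theta>\<^sub>1 (a \<otimes> b) c)) b) \<otimes> \<gamma> a (\<Theta>\<^sub>1 (a \<otimes> b) c)
             = \<Theta>\<^sub>1 (\<sigma> (\<Theta>\<^sub>2 a (b \<otimes> c)) b) (\<sigma> (\<gamma> b (\<Theta>\<^sub>2 a (b \<otimes> c))) c) \<otimes> \<Theta>\<^sub>2 a (b \<otimes> c)"
begin

abbreviation F :: "'a \<times> 'a \<Rightarrow> 'a \<times> 'a" where
  "F \<equiv> twist_map \<sigma> \<Theta>\<^sub>1 \<Theta>\<^sub>2"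

abbreviation H :: "'a monoid" where
  "H \<equiv> twisted_group G F"

abbreviation r' :: "'a \<times> 'a \<Rightarrow> 'a \<times> 'a" where
  "r' \<equiv> F \<circ> r \<circ> inv_on_pairs G F"

abbreviation G2 :: "('a \<times> 'a) set" where
  "G2 \<equiv> carrier G \<times> carrier G"

abbreviation G3 :: "('a \<times> 'a \<times> 'a) set" where
  "G3 \<equiv> carrier G \<times> carrier G \<times> carrier G"

lemma F_closed: "F \<in> G2 \<rightarrow> G2"
  using twist_bij by (rule bij_betw_imp_funcset)

lemma F_onto:
  assumes "q \<in> G2"
  obtains p where "p \<in> G2" "q = F p"
  using assms twist_bij by (metis bij_betw_imp_surj_on imageE)

lemma inv_F: "p \<in> G2 \<Longrightarrow> inv_on_pairs G F (F p) = p"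
  using twist_bij by (simp add: inv_on_pairs_def bij_betw_def inv_into_f_f)

lemma F_one_left: "a \<in> carrier G \<Longrightarrow> F (\<one>, a) = (\<one>, a)"
  and F_one_right: "a \<in> carrier G \<Longrightarrow> F (a, \<one>) = (a, \<one>)"
  by (simp_all add: twist_map_def)

lemma carrier_H [simp]: "carrier H = carrier G"
  and one_H [simp]: "\<one>\<^bsub>H\<^esub> = \<one>"
  by (simp_all add: twisted_group_def)

lemma mult_H: "x \<otimes>\<^bsub>H\<^esub> y = mult_map G (inv_on_pairs G F (x, y))"
  by (simp add: twisted_group_def)

lemma mult_map_H_F: "p \<in> G2 \<Longrightarrow> mult_map H (F p) = mult_map G p"
  by (cases "F p") (metis case_prod_conv inv_F mult_H mult_map_def)

lemma mult_H_F:
  assumes "a \<in> carrier G" "b \<in> carrier G" "F (a, b) = (u, v)"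
  shows "u \<otimes>\<^bsub>H\<^esub> v = a \<otimes> b"
  using mult_map_H_F[of "(a, b)"] assms by (simp add: mult_map_def)

lemma r'_F: "p \<in> G2 \<Longrightarrow> r' (F p) = F (r p)"
  by (simp add: inv_F)

lemma r'_closed: "r' \<in> G2 \<rightarrow> G2"
proof
  fix q assume "q \<in> G2"
  then obtain p where p: "p \<in> G2" "q = F p" by (rule F_onto)
  then have "F (r p) \<in> G2" by (intro funcset_mem[OF F_closed] funcset_mem[OF r_closed])
  then show "r' q \<in> G2" using p by (simp only: r'_F)
qed

definition \<Psi> :: "'a \<times> 'a \<times> 'a \<Rightarrow> 'a \<times> 'a \<times> 'a" where
  "\<Psi> = (\<lambda>(a, b, c). case act2 (\<Theta>\<^sub>1 (a \<otimes> b) c) (a, b) of (u, v) \<Rightarrow> (u, v, \<sigma> (\<Theta>\<^sub>2 (a \<otimes> b) c) c))"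

definition \<Phi> :: "'a \<times> 'a \<times> 'a \<Rightarrow> 'a \<times> 'a \<times> 'a" where
  "\<Phi> = (\<lambda>(a, b, c). (\<sigma> (\<Theta>\<^sub>1 a (b \<otimes> c)) a, act2 (\<Theta>\<^sub>2 a (b \<otimes> c)) (b, c)))"

definition K :: "'a \<times> 'a \<times> 'a \<Rightarrow> 'a \<times> 'a \<times> 'a" where
  "K t = map12 F (\<Psi> t)"

lemma \<Psi>_closed: "t \<in> G3 \<Longrightarrow> \<Psi> t \<in> G3"
  by (auto simp: \<Psi>_def act2_def)

lemma \<Phi>_closed: "t \<in> G3 \<Longrightarrow> \<Phi> t \<in> G3"
  by (auto simp: \<Phi>_def act2_def)

lemma K_closed: "t \<in> G3 \<Longrightarrow> K t \<in> G3"
  unfolding K_def by (intro map12_closed F_closed \<Psi>_closed)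

lemma F_mult12: "t \<in> G3 \<Longrightarrow> F (mult12 G t) = mult12 G (\<Psi> t)"
  by (auto simp: \<Psi>_def act2_def mult12_def twist_map_def \<sigma>_mult)

lemma F_mult23: "t \<in> G3 \<Longrightarrow> F (mult23 G t) = mult23 G (\<Phi> t)"
  by (auto simp: \<Phi>_def act2_def mult23_def twist_map_def \<sigma>_mult)

text \<open>
  Both sides move each of \<open>a\<close>, \<open>b\<close>, \<open>c\<close> by one application of \<open>\<sigma>\<close>, once the successive actions are
  merged; the subscripts for \<open>a\<close>, \<open>b\<close>, \<open>c\<close> are the two sides of \<open>\<Theta>_left\<close>, \<open>\<Theta>_middle\<close>, \<open>\<Theta>_right\<close>.
\<close>

lemma coassociativity:
  assumes "t \<in> G3"
  shows "map12 F (\<Psi> t) = map23 F (\<Phi> t)"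
proof -
  obtain a b c where t: "t = (a, b, c)" "a \<in> carrier G" "b \<in> carrier G" "c \<in> carrier G"
    using assms by auto
  show ?thesis
    using t \<Theta>_left[of a b c] \<Theta>_right[of a b c] \<Theta>_middle[of a b c]
    by (simp add: \<Psi>_def \<Phi>_def act2_def map12_def map23_def twist_map_def \<sigma>_action [symmetric])
qed

lemma K_eq: "t \<in> G3 \<Longrightarrow> K t = map23 F (\<Phi> t)"
  by (simp add: K_def coassociativity)

text \<open>
  From \<open>\<Psi>(a, b, c)\<close> one reads off \<open>F(ab, c)\<close>, hence \<open>(ab, c)\<close> and the subscript \<open>\<Theta>\<^sub>1(ab, c)\<close>. So a
  preimage is found by inverting \<open>F\<close> at the product of the first two entries, and then undoing the
  diagonal action; that the resulting \<open>ab\<close> is the right one follows by cancelling \<open>\<sigma>\<close>.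
\<close>

lemma \<Psi>_onto:
  assumes "s \<in> G3"
  obtains t where "t \<in> G3" "s = \<Psi> t"
proof -
  obtain u v w where s: "s = (u, v, w)" "u \<in> carrier G" "v \<in> carrier G" "w \<in> carrier G"
    using assms by auto
  then have "(u \<otimes> v, w) \<in> G2"
    by simp
  then obtain p c where pc: "p \<in> carrier G" "c \<in> carrier G" "(u \<otimes> v, w) = F (p, c)"
    by (metis F_onto mem_Sigma_iff surj_pair)
  let ?x = "\<Theta>\<^sub>1 p c"
  have x: "?x \<in> carrier G"
    using pc by simp
  obtain a b where ab: "a \<in> carrier G" "b \<in> carrier G" "act2 ?x (a, b) = (u, v)"
    using act2_onto[OF x, of "(u, v)"] s by (metis mem_Sigma_iff surj_pair)
  have "\<sigma> ?x (a \<otimes> b) = u \<otimes> v"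
    using mult_act2[OF x, of "(a, b)"] ab by (simp add: mult_map_def)
  also have "\<dots> = \<sigma> ?x p"
    using pc by (simp add: twist_map_def)
  finally have "a \<otimes> b = p"
    using \<sigma>_inv_left[OF x, of "a \<otimes> b"] \<sigma>_inv_left[OF x pc(1)] ab by simp
  then have "\<Psi> (a, b, c) = s"
    using ab pc s by (simp add: \<Psi>_def twist_map_def)
  with ab pc that show ?thesis by blast
qed

lemma K_onto:
  assumes "s \<in> G3"
  obtains t where "t \<in> G3" "s = K t"
proof -
  obtain x y z where s: "s = (x, y, z)" "x \<in> carrier G" "y \<in> carrier G" "z \<in> carrier G"
    using assms by auto
  then obtain u v where uv: "u \<in> carrier G" "v \<in> carrier G" "(x, y) = F (u, v)"
    by (metis F_onto mem_Sigma_iff surj_pair)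
  then obtain t where t: "t \<in> G3" "(u, v, z) = \<Psi> t"
    using s by (metis \<Psi>_onto mem_Sigma_iff)
  have "K t = s"
    using t(2) [symmetric] uv(3) [symmetric] s by (simp add: K_def map12_def)
  with t that show ?thesis by blast
qed

lemma mult12_H_map12_F: "t \<in> G3 \<Longrightarrow> mult12 H (map12 F t) = mult12 G t"
  by (auto simp: mult12_def map12_def mult_H_F split: prod.splits)

lemma mult23_H_map23_F: "t \<in> G3 \<Longrightarrow> mult23 H (map23 F t) = mult23 G t"
  by (auto simp: mult23_def map23_def mult_H_F split: prod.splits)

lemma mult12_K: "t \<in> G3 \<Longrightarrow> mult12 H (K t) = F (mult12 G t)"
  by (simp add: K_def mult12_H_map12_F \<Psi>_closed F_mult12)

lemma mult23_K: "t \<in> G3 \<Longrightarrow> mult23 H (K t) = F (mult23 G t)"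
  by (simp add: K_eq mult23_H_map23_F \<Phi>_closed F_mult23)

section \<open>The twisted group\<close>

lemma mult_H_closed:
  assumes "x \<in> carrier G" "y \<in> carrier G"
  shows "x \<otimes>\<^bsub>H\<^esub> y \<in> carrier G"
proof -
  obtain p where "p \<in> G2" "(x, y) = F p"
    using assms by (metis F_onto mem_Sigma_iff)
  then show ?thesis
    by (auto simp: mult_H inv_F mult_map_def)
qed

lemma H_one_left: "x \<in> carrier G \<Longrightarrow> \<one> \<otimes>\<^bsub>H\<^esub> x = x"
  using inv_F[of "(\<one>, x)"] by (simp add: F_one_left mult_H mult_map_def)

lemma H_one_right: "x \<in> carrier G \<Longrightarrow> x \<otimes>\<^bsub>H\<^esub> \<one> = x"
  using inv_F[of "(x, \<one>)"] by (simp add: F_one_right mult_H mult_map_def)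

lemma H_assoc:
  assumes "x \<in> carrier G" "y \<in> carrier G" "z \<in> carrier G"
  shows "(x \<otimes>\<^bsub>H\<^esub> y) \<otimes>\<^bsub>H\<^esub> z = x \<otimes>\<^bsub>H\<^esub> (y \<otimes>\<^bsub>H\<^esub> z)"
proof -
  obtain t where t: "t \<in> G3" "(x, y, z) = K t"
    using assms by (metis K_onto mem_Sigma_iff)
  obtain a b c where abc: "t = (a, b, c)" "a \<in> carrier G" "b \<in> carrier G" "c \<in> carrier G"
    using t by auto
  have "(x \<otimes>\<^bsub>H\<^esub> y, z) = F (a \<otimes> b, c)"
    using mult12_K[OF t(1)] t(2) [symmetric] abc by (simp add: mult12_def)
  then have "(x \<otimes>\<^bsub>H\<^esub> y) \<otimes>\<^bsub>H\<^esub> z = (a \<otimes> b) \<otimes> c"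
    using abc by (simp add: mult_H[of "x \<otimes>\<^bsub>H\<^esub> y" z] inv_F mult_map_def)
  moreover have "(x, y \<otimes>\<^bsub>H\<^esub> z) = F (a, b \<otimes> c)"
    using mult23_K[OF t(1)] t(2) [symmetric] abc by (simp add: mult23_def)
  then have "x \<otimes>\<^bsub>H\<^esub> (y \<otimes>\<^bsub>H\<^esub> z) = a \<otimes> (b \<otimes> c)"
    using abc by (simp add: mult_H[of x "y \<otimes>\<^bsub>H\<^esub> z"] inv_F mult_map_def)
  ultimately show ?thesis
    using abc by (simp add: m_assoc)
qed

text \<open>
  For \<open>K(a, a\<^sup>-\<^sup>1, a) = (a, y, z)\<close> the lemmas on \<open>K\<close> give \<open>a y = e\<close> and \<open>y z = e\<close> in the twisted
  monoid, so \<open>y\<close> has left inverse \<open>a\<close> and right inverse \<open>z\<close>, and these coincide.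
\<close>

lemma H_left_inverse:
  assumes a: "a \<in> carrier G"
  shows "\<exists>y \<in> carrier G. y \<otimes>\<^bsub>H\<^esub> a = \<one>"
proof -
  let ?t = "(a, inv a, a)"
  have t: "?t \<in> G3"
    using a by simp
  obtain x y z where K: "K ?t = (x, y, z)"
    by (cases "K ?t") auto
  have yz: "x \<in> carrier G" "y \<in> carrier G" "z \<in> carrier G"
    using K_closed[OF t] K by auto
  have "x = a"
    using K_eq[OF t] K a by (simp add: map23_def \<Phi>_def)
  moreover have "x \<otimes>\<^bsub>H\<^esub> y = \<one>"
    using mult12_K[OF t] K a by (simp add: mult12_def F_one_left)
  moreover have "y \<otimes>\<^bsub>H\<^esub> z = \<one>"
    using mult23_K[OF t] K a by (simp add: mult23_def F_one_right)
  moreover have "x = z"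
    using H_assoc[OF yz] calculation yz by (simp add: H_one_left H_one_right)
  ultimately show ?thesis
    using yz by blast
qed

lemma group_H: "group H"
  by (rule groupI) (auto simp: mult_H_closed H_one_left H_assoc H_left_inverse)

section \<open>The twisted braiding operator\<close>

text \<open>As \<open>r\<close> preserves products, \<open>\<Theta>\<close> takes the same values at \<open>r\<^sub>1\<^sub>2 t\<close>, respectively \<open>r\<^sub>2\<^sub>3 t\<close>, as at
  \<open>t\<close>, and the claim becomes the equivariance of \<open>r\<close> under the diagonal action.\<close>

lemma \<Psi>_map12_r:
  assumes "t \<in> G3"
  shows "\<Psi> (map12 r t) = map12 r (\<Psi> t)"
proof -
  obtain a b c where t: "t = (a, b, c)" "a \<in> carrier G" "b \<in> carrier G" "c \<in> carrier G"
    using assms by auto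
  have "r (act2 (\<Theta>\<^sub>1 (a \<otimes> b) c) (a, b)) = act2 (\<Theta>\<^sub>1 (a \<otimes> b) c) (r (a, b))"
    using t by (intro r_act2) auto
  then show ?thesis
    using t \<sigma>_mult_\<gamma>[of a b]
    by (auto simp: \<Psi>_def map12_def r_eq split: prod.splits)
qed

lemma \<Phi>_map23_r:
  assumes "t \<in> G3"
  shows "\<Phi> (map23 r t) = map23 r (\<Phi> t)"
proof -
  obtain a b c where t: "t = (a, b, c)" "a \<in> carrier G" "b \<in> carrier G" "c \<in> carrier G"
    using assms by auto
  have "r (act2 (\<Theta>\<^sub>2 a (b \<otimes> c)) (b, c)) = act2 (\<Theta>\<^sub>2 a (b \<otimes> c)) (r (b, c))"
    using t by (intro r_act2) auto
  then show ?thesis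
    using t \<sigma>_mult_\<gamma>[of b c]
    by (auto simp: \<Phi>_def map23_def r_eq split: prod.splits)
qed

lemma map12_r'_K:
  assumes "t \<in> G3"
  shows "map12 r' (K t) = K (map12 r t)"
proof -
  have "map12 r' (map12 F s) = map12 F (map12 r s)" if "s \<in> G3" for s
    using that r'_F[of "(fst s, fst (snd s))"]
    by (auto simp: map12_def simp del: comp_apply split: prod.splits)
  then show ?thesis
    using assms by (simp add: K_def \<Psi>_closed \<Psi>_map12_r)
qed

lemma map23_r'_K:
  assumes "t \<in> G3"
  shows "map23 r' (K t) = K (map23 r t)"
proof -
  have "map23 r' (map23 F s) = map23 F (map23 r s)" if "s \<in> G3" for s
    using that r'_F[of "snd s"]
    by (auto simp: map23_def simp del: comp_apply split: prod.splits)
  then show ?thesis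
    using assms map23_closed[OF r_closed assms] by (simp add: K_eq \<Phi>_closed \<Phi>_map23_r)
qed

lemma r'_mult12:
  assumes "s \<in> G3"
  shows "r' (mult12 H s) = mult23 H (map12 r' (map23 r' s))"
proof -
  obtain t where t: "t \<in> G3" "s = K t"
    using assms by (rule K_onto)
  have t': "map23 r t \<in> G3" "map12 r (map23 r t) \<in> G3" "mult12 G t \<in> G2"
    using t by (auto intro!: map12_closed map23_closed r_closed simp: mult12_def)
  have "r' (mult12 H s) = F (r (mult12 G t))"
    using t t' by (simp only: mult12_K r'_F)
  also have "\<dots> = F (mult23 G (map12 r (map23 r t)))"
    using t by (simp add: r_mult12)
  also have "\<dots> = mult23 H (K (map12 r (map23 r t)))"
    using t' by (simp add: mult23_K)
  also have "\<dots> = mult23 H (map12 r' (map23 r' s))"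
    using t t' by (simp only: map12_r'_K map23_r'_K)
  finally show ?thesis .
qed

lemma r'_mult23:
  assumes "s \<in> G3"
  shows "r' (mult23 H s) = mult12 H (map23 r' (map12 r' s))"
proof -
  obtain t where t: "t \<in> G3" "s = K t"
    using assms by (rule K_onto)
  have t': "map12 r t \<in> G3" "map23 r (map12 r t) \<in> G3" "mult23 G t \<in> G2"
    using t by (auto intro!: map12_closed map23_closed r_closed simp: mult23_def)
  have "r' (mult23 H s) = F (r (mult23 G t))"
    using t t' by (simp only: mult23_K r'_F)
  also have "\<dots> = F (mult12 G (map23 r (map12 r t)))"
    using t by (simp add: r_mult23)
  also have "\<dots> = mult12 H (K (map23 r (map12 r t)))"
    using t' by (simp add: mult12_K)
  also have "\<dots> = mult12 H (map23 r' (map12 r' s))"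
    using t t' by (simp only: map12_r'_K map23_r'_K)
  finally show ?thesis .
qed

lemma r'_one:
  assumes "g \<in> carrier G"
  shows "r' (\<one>, g) = (g, \<one>)" "r' (g, \<one>) = (\<one>, g)"
  using assms r'_F[of "(\<one>, g)"] r'_F[of "(g, \<one>)"]
  by (simp_all add: F_one_left F_one_right r_one_left r_one_right del: comp_apply)

lemma mult_r':
  assumes "q \<in> G2"
  shows "mult_map H (r' q) = mult_map H q"
proof -
  obtain p where p: "p \<in> G2" "q = F p"
    using assms by (rule F_onto)
  moreover have "r p \<in> G2"
    using p r_closed by auto
  ultimately show ?thesis
    by (simp only: r'_F mult_map_H_F mult_r)
qed

lemma braiding_H: "braiding_operator H r'"
  unfolding braiding_operator_def carrier_H one_H
proof (intro conjI ballI)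
  show "r' \<in> G2 \<rightarrow> G2"
    by (rule r'_closed)
  show "r' (\<one>, g) = (g, \<one>)" "r' (g, \<one>) = (\<one>, g)" if "g \<in> carrier G" for g
    using that by (rule r'_one)+
  show "(r' \<circ> mult12 H) s = (mult23 H \<circ> map12 r' \<circ> map23 r') s" if "s \<in> G3" for s
    using r'_mult12[OF that] by simp
  show "(r' \<circ> mult23 H) s = (mult12 H \<circ> map23 r' \<circ> map12 r') s" if "s \<in> G3" for s
    using r'_mult23[OF that] by simp
  show "(mult_map H \<circ> r') q = mult_map H q" if "q \<in> G2" for q
    using mult_r'[OF that] by simp
qed

end

section \<open>Twists of braided groups\<close>

theorem corollary4p4:
  fixes G :: "('a, 'b) monoid_scheme" (structure)
    and r \<Theta> :: "'a \<times> 'a \<Rightarrow> 'a \<times> 'a"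
    and \<sigma> \<gamma> \<Theta>\<^sub>1 \<Theta>\<^sub>2 :: "'a \<Rightarrow> 'a \<Rightarrow> 'a"
  assumes "group G"
    and "braiding_operator G r"
    and "\<And>x y. x \<in> carrier G \<Longrightarrow> y \<in> carrier G \<Longrightarrow> r (x, y) = (\<sigma> x y, \<gamma> y x)"
    and "\<Theta> \<in> carrier G \<times> carrier G \<rightarrow> carrier G \<times> carrier G"
    and "\<And>x y. x \<in> carrier G \<Longrightarrow> y \<in> carrier G \<Longrightarrow> \<Theta> (x, y) = (\<Theta>\<^sub>1 x y, \<Theta>\<^sub>2 x y)"
    and "bij_betw (twist_map \<sigma> \<Theta>\<^sub>1 \<Theta>\<^sub>2) (carrier G \<times> carrier G) (carrier G \<times> carrier G)"
    and "\<And>a. a \<in> carrier G \<Longrightarrow> \<Theta>\<^sub>2 \<one> a = \<one>"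
    and "\<And>a. a \<in> carrier G \<Longrightarrow> \<Theta>\<^sub>1 a \<one> = \<one>"
    and "\<And>a b c. a \<in> carrier G \<Longrightarrow> b \<in> carrier G \<Longrightarrow> c \<in> carrier G \<Longrightarrow>
           \<Theta>\<^sub>1 (\<sigma> (\<Theta>\<^sub>1 (a \<otimes> b) c) a) (\<sigma> (\<gamma> a (\<Theta>\<^sub>1 (a \<otimes> b) c)) b) \<otimes> \<Theta>\<^sub>1 (a \<otimes> b) c
             = \<Theta>\<^sub>1 a (b \<otimes> c)"
    and "\<And>a b c. a \<in> carrier G \<Longrightarrow> b \<in> carrier G \<Longrightarrow> c \<in> carrier G \<Longrightarrow>
           \<Theta>\<^sub>2 (a \<otimes> b) c
             = \<Theta>\<^sub>2 (\<sigma> (\<Theta>\<^sub>2 a (b \<otimes> c)) b) (\<sigma> (\<gamma> b (\<Theta>\<^sub>2 a (b \<otimes> c))) c) \<otimes> \<gamma> b (\<Theta>\<^sub>2 a (b \<otimes> c))"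
    and "\<And>a b c. a \<in> carrier G \<Longrightarrow> b \<in> carrier G \<Longrightarrow> c \<in> carrier G \<Longrightarrow>
           \<Theta>\<^sub>2 (\<sigma> (\<Theta>\<^sub>1 (a \<otimes> b) c) a) (\<sigma> (\<gamma> a (\<Theta>\<^sub>1 (a \<otimes> b) c)) b) \<otimes> \<gamma> a (\<Theta>\<^sub>1 (a \<otimes> b) c)
             = \<Theta>\<^sub>1 (\<sigma> (\<Theta>\<^sub>2 a (b \<otimes> c)) b) (\<sigma> (\<gamma> b (\<Theta>\<^sub>2 a (b \<otimes> c))) c) \<otimes> \<Theta>\<^sub>2 a (b \<otimes> c)"
  shows "group (twisted_group G (twist_map \<sigma> \<Theta>\<^sub>1 \<Theta>\<^sub>2)) \<and>
         braiding_operator (twisted_group G (twist_map \<sigma> \<Theta>\<^sub>1 \<Theta>\<^sub>2))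
           (twist_map \<sigma> \<Theta>\<^sub>1 \<Theta>\<^sub>2 \<circ> r \<circ> inv_on_pairs G (twist_map \<sigma> \<Theta>\<^sub>1 \<Theta>\<^sub>2))"
proof -
  have "\<Theta>\<^sub>1 x y \<in> carrier G" "\<Theta>\<^sub>2 x y \<in> carrier G" if "x \<in> carrier G" "y \<in> carrier G" for x y
    using funcset_mem[OF assms(4), of "(x, y)"] assms(5)[OF that] that by auto
  then interpret twisted_braided_group G r \<sigma> \<gamma> \<Theta>\<^sub>1 \<Theta>\<^sub>2
    using assms
    by (intro twisted_braided_group.intro braided_group.intro braided_group_axioms.intro
        twisted_braided_group_axioms.intro)
  show ?thesis
    using group_H braiding_H by blast
qed

end
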